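(* Let $p$ be a prime with $p\equiv 1\pmod 3$, $\mathcal{R}=\mathbb{F}_p+u\mathbb{F}_p+u^2\mathbb{F}_p+u^3\mathbb{F}_p$ with $u^4=u$, and $\eta_1,\dots,\eta_4$ the idempotents defined below. Let $\mathcal{C}$ be a $(1-2u^3)$-constacyclic code of length $n$ over $\mathcal{R}$ generated by $g(x)=\eta_1g_1(x)+\eta_2g_2(x)+\eta_3g_3(x)+\eta_4g_4(x)$, where $g_1,\dots,g_4\in\mathbb{F}_p[x]$ are the monic generator polynomials of the component codes $\mathcal{C}_1$ (cyclic) and $\mathcal{C}_2,\mathcal{C}_3,\mathcal{C}_4$ (negacyclic). Then the Gray image $\Phi(\mathcal{C})$ is a cyclic code of length $2n$ over $\mathbb{F}_p$ contained in the ideal $\langle g_1(x)\lambda(x)\rangle$ of $\mathbb{F}_p[x]/\langle x^{2n}-1\rangle$, where $\lambda(x)=\gcd(g_2(x),g_3(x),g_4(x))$ in $\mathbb{F}_p[x]$.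
   Context: Let $\xi\in\mathbb{F}_p$ be a primitive cube root of unity. Set $\eta_1=1-u^3$, $\eta_2=3^{-1}(u+u^2+u^3)$, $\eta_3=3^{-1}(\xi u+\xi^2u^2+u^3)$, $\eta_4=3^{-1}(\xi^2u+\xi u^2+u^3)$; these are pairwise orthogonal idempotents summing to $1$, and every $(1-2u^3)$-constacyclic code is $\mathcal{C}=\bigoplus_i\eta_i\mathcal{C}_i$ with $\mathcal{C}_i\subseteq\mathbb{F}_p^n$ its component codes ($\mathcal{C}_j$ being the set of $j$-th components $x_j$ of elements $\sum_k\eta_kx_k\in\mathcal{C}$, $x_k\in\mathbb{F}_p^n$). Codes are identified with ideals: $\mathcal{C}\subseteq\mathcal{R}[x]/\langle x^n-(1-2u^3)\rangle$, cyclic codes over $\mathbb{F}_p$ with ideals of $\mathbb{F}_p[x]/\langle x^m-1\rangle$, negacyclic ones with ideals of $\mathbb{F}_p[x]/\langle x^n+1\rangle$. The Gray map in polynomial form is $\Phi(a(x)+b(x)u+c(x)u^2+d(x)u^3)=-d(x)+x^n(2a(x)+d(x))\in\mathbb{F}_p[x]/\langle x^{2n}-1\rangle$ for $a,b,c,d\in\mathbb{F}_p[x]$ of degree $<n$ (equivalently $(r_i)\mapsto(-d_0,\dots,-d_{n-1},2a_0+d_0,\dots,2a_{n-1}+d_{n-1})$ with $r_i=a_i+b_iu+c_iu^2+d_iu^3$). *)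

theory Defs
  imports
    "HOL-Algebra.QuotRing"
    "HOL-Algebra.Algebraic_Closure_Type"
    "Berlekamp_Zassenhaus.Finite_Field"
begin

hide_const (open) UnivPoly.coeff UnivPoly.monom UnivPoly.deg Module.smult

section \<open>The ring \<open>K + uK + u\<^sup>2K + u\<^sup>3K\<close> with \<open>u\<^sup>4 = u\<close>\<close>

text \<open>\<open>RU a b c d\<close> stands for \<open>a + bu + cu\<^sup>2 + du\<^sup>3\<close>; see \<open>ru_u_power4\<close> and \<open>RU_expand\<close>.\<close>

datatype 'a ru = RU (ru_coeff0: 'a) (ru_coeff1: 'a) (ru_coeff2: 'a) (ru_coeff3: 'a)

instantiation ru :: (comm_ring_1) comm_ring_1
begin

definition "0 = RU 0 0 0 0"
definition "1 = RU 1 0 0 0"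
definition "x + y = RU (ru_coeff0 x + ru_coeff0 y) (ru_coeff1 x + ru_coeff1 y)
  (ru_coeff2 x + ru_coeff2 y) (ru_coeff3 x + ru_coeff3 y)"
definition "- x = RU (- ru_coeff0 x) (- ru_coeff1 x) (- ru_coeff2 x) (- ru_coeff3 x)"
definition "x - y = RU (ru_coeff0 x - ru_coeff0 y) (ru_coeff1 x - ru_coeff1 y)
  (ru_coeff2 x - ru_coeff2 y) (ru_coeff3 x - ru_coeff3 y)"

text \<open>Reduction uses \<open>u\<^sup>4 = u\<close>, \<open>u\<^sup>5 = u\<^sup>2\<close>, \<open>u\<^sup>6 = u\<^sup>3\<close>.\<close>

definition "x * y = RU
  (ru_coeff0 x * ru_coeff0 y)
  (ru_coeff0 x * ru_coeff1 y + ru_coeff1 x * ru_coeff0 y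
    + ru_coeff1 x * ru_coeff3 y + ru_coeff2 x * ru_coeff2 y + ru_coeff3 x * ru_coeff1 y)
  (ru_coeff0 x * ru_coeff2 y + ru_coeff1 x * ru_coeff1 y + ru_coeff2 x * ru_coeff0 y
    + ru_coeff2 x * ru_coeff3 y + ru_coeff3 x * ru_coeff2 y)
  (ru_coeff0 x * ru_coeff3 y + ru_coeff1 x * ru_coeff2 y
    + ru_coeff2 x * ru_coeff1 y + ru_coeff3 x * ru_coeff0 y
    + ru_coeff3 x * ru_coeff3 y)"

instance
  by standard
    (auto simp: zero_ru_def one_ru_def plus_ru_def uminus_ru_def minus_ru_def times_ru_def
      algebra_simps)

end

definition ru_u :: "'a::comm_ring_1 ru" where
  "ru_u = RU 0 1 0 0"

definition ru_const :: "'a::comm_ring_1 \<Rightarrow> 'a ru" where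
  "ru_const a = RU a 0 0 0"

lemma ru_u_power4: "(ru_u :: 'a::comm_ring_1 ru) ^ 4 = ru_u"
  by (simp add: ru_u_def times_ru_def one_ru_def eval_nat_numeral)

lemma RU_expand:
  "RU a b c d = ru_const a + ru_const b * ru_u + ru_const c * ru_u ^ 2 + ru_const d * ru_u ^ 3"
  by (simp add: ru_u_def ru_const_def times_ru_def plus_ru_def one_ru_def eval_nat_numeral)

definition primitive_root_of_unity :: "nat \<Rightarrow> 'a::comm_ring_1 \<Rightarrow> bool" where
  "primitive_root_of_unity k x \<longleftrightarrow> x ^ k = 1 \<and> (\<forall>j. 0 < j \<and> j < k \<longrightarrow> x ^ j \<noteq> 1)"

definition eta :: "'a::field \<Rightarrow> nat \<Rightarrow> 'a ru" where
  "eta \<xi> i =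
    (if i = 1 then 1 - ru_u ^ 3
     else if i = 2 then ru_const (inverse 3) * (ru_u + ru_u ^ 2 + ru_u ^ 3)
     else if i = 3 then
       ru_const (inverse 3) * (ru_const \<xi> * ru_u + ru_const (\<xi> ^ 2) * ru_u ^ 2 + ru_u ^ 3)
     else if i = 4 then
       ru_const (inverse 3) * (ru_const (\<xi> ^ 2) * ru_u + ru_const \<xi> * ru_u ^ 2 + ru_u ^ 3)
     else 0)"


section \<open>Constacyclic codes as ideals\<close>

text \<open>\<open>cc_ring n a\<close> is \<open>A[x]/\<langle>x\<^sup>n - a\<rangle>\<close>, and \<open>cc_class n a f\<close> is the residue class of \<open>f\<close> in it.\<close>

definition cc_modulus :: "nat \<Rightarrow> 'a::comm_ring_1 \<Rightarrow> 'a poly set" where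
  "cc_modulus n a =
    PIdl\<^bsub>(ring_of_type_algebra :: 'a poly ring)\<^esub> (Polynomial.monom 1 n - [:a:])"

definition cc_ring :: "nat \<Rightarrow> 'a::comm_ring_1 \<Rightarrow> 'a poly set ring" where
  "cc_ring n a = ring_of_type_algebra Quot cc_modulus n a"

definition cc_class :: "nat \<Rightarrow> 'a::comm_ring_1 \<Rightarrow> 'a poly \<Rightarrow> 'a poly set" where
  "cc_class n a f = cc_modulus n a +>\<^bsub>ring_of_type_algebra\<^esub> f"

definition constacyclic_code :: "nat \<Rightarrow> 'a::comm_ring_1 \<Rightarrow> 'a poly set set \<Rightarrow> bool" where
  "constacyclic_code n a C \<longleftrightarrow> ideal C (cc_ring n a)"

abbreviation cyclic_code :: "nat \<Rightarrow> 'a::comm_ring_1 poly set set \<Rightarrow> bool" where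
  "cyclic_code n \<equiv> constacyclic_code n 1"

text \<open>
  A word \<open>(c\<^sub>0, \<dots>, c\<^bsub>n-1\<^esub>)\<close> of length \<open>n \<ge> 1\<close> is the polynomial \<open>c\<^sub>0 + \<dots> + c\<^bsub>n-1\<^esub>x\<^bsup>n-1\<^esup>\<close>. As
  \<open>degree 0 = 0\<close>, the zero word is included.
\<close>

definition words :: "nat \<Rightarrow> 'a::zero poly set" where
  "words n = {f. degree f < n}"

text \<open>
  The monic generator of a set \<open>D\<close> of words whose classes form an ideal. Divisibility singles
  out one monic generator of this ideal; for the zero code it is \<open>x\<^sup>n - a\<close>.
\<close>

definition generator_poly :: "nat \<Rightarrow> 'a::field \<Rightarrow> 'a poly set \<Rightarrow> 'a poly \<Rightarrow> bool" where
  "generator_poly n a D g \<longleftrightarrow>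
    lead_coeff g = 1 \<and> g dvd Polynomial.monom 1 n - [:a:] \<and>
    cc_class n a ` D = PIdl\<^bsub>cc_ring n a\<^esub> (cc_class n a g)"

definition eta_combination :: "'a::field \<Rightarrow> (nat \<Rightarrow> 'a poly) \<Rightarrow> 'a ru poly" where
  "eta_combination \<xi> x = (\<Sum>k=1..4. Polynomial.smult (eta \<xi> k) (map_poly ru_const (x k)))"

definition component_code :: "'a::field \<Rightarrow> nat \<Rightarrow> 'a ru poly set set \<Rightarrow> nat \<Rightarrow> 'a poly set" where
  "component_code \<xi> n C j =
    {x j | x. (\<forall>k\<in>{1..4}. x k \<in> words n) \<and>
      cc_class n (1 - 2 * ru_u ^ 3) (eta_combination \<xi> x) \<in> C}"


section \<open>The Gray map\<close>

definition reduced_rep :: "nat \<Rightarrow> 'a::zero poly set \<Rightarrow> 'a poly" where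
  "reduced_rep n A = (THE f. f \<in> A \<and> f \<in> words n)"

definition gray_poly :: "nat \<Rightarrow> 'a::comm_ring_1 ru poly \<Rightarrow> 'a poly" where
  "gray_poly n f =
    (let a = map_poly ru_coeff0 f; d = map_poly ru_coeff3 f
     in - d + Polynomial.monom 1 n * (Polynomial.smult 2 a + d))"

definition gray :: "nat \<Rightarrow> 'a::comm_ring_1 ru poly set \<Rightarrow> 'a poly set" where
  "gray n A = cc_class (2 * n) 1 (gray_poly n (reduced_rep n A))"

lemma cc_class_eq: "cc_class n a f = {f + q * (Polynomial.monom 1 n - [:a:]) | q. True}"
  unfolding cc_class_def cc_modulus_def a_r_coset_def r_coset_def cgenideal_def
    ring_of_type_algebra_def
  by (auto simp: add.commute)

lemma reduced_rep_cc_class: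
  assumes "f \<in> words n"
  shows "reduced_rep n (cc_class n a f) = f"
proof -
  define m where "m = Polynomial.monom 1 n - [:a:]"
  have n: "n > 0" using assms by (auto simp: words_def)
  have cn: "Polynomial.coeff m n = 1"
    using n by (cases n) (simp_all add: m_def)
  have dm: "degree m = n"
  proof (rule antisym)
    show "degree m \<le> n"
      unfolding m_def by (rule degree_diff_le) (auto simp: degree_monom_le)
    show "n \<le> degree m" using cn by (intro le_degree) auto
  qed
  have lm: "lead_coeff m = 1" using cn dm by simp
  have uniq: "h = f" if h: "h \<in> cc_class n a f" "h \<in> words n" for h
  proof -
    obtain q where q: "h = f + q * m"
      using h(1) by (auto simp: cc_class_eq m_def)
    have "degree (h - f) < n"
      using h(2) assms degree_diff_less by (auto simp: words_def)
    hence d: "degree (q * m) < n" using q by simp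
    have "q = 0"
    proof (rule ccontr)
      assume "q \<noteq> 0"
      have "Polynomial.coeff (q * m) (degree q + degree m) = lead_coeff q"
        using lm by (simp add: coeff_mult_degree_sum)
      hence "degree q + degree m \<le> degree (q * m)"
        using \<open>q \<noteq> 0\<close> by (intro le_degree) auto
      with d dm show False by simp
    qed
    with q show ?thesis by simp
  qed
  have "f \<in> cc_class n a f" unfolding cc_class_eq by (auto intro: exI[of _ 0])
  thus ?thesis unfolding reduced_rep_def using assms uniq by (intro the_equality) auto
qed

end

theory Submission
  imports Defs
begin

text \<open>
  Put \<open>G(f) = -d + x\<^sup>n(2a + d)\<close> for a polynomial \<open>f = a + bu + cu\<^sup>2 + du\<^sup>3\<close> of any degree. The map
  \<open>G\<close> is linear over \<open>K[x]\<close> and sends \<open>q (x\<^sup>n - (1 - 2u\<^sup>3))\<close> to a multiple of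
  \<open>x\<^sup>2\<^sup>n - 1\<close>, so the Gray map is induced by \<open>G\<close> without reducing degrees first. Hence the Gray
  image is an ideal. For \<open>f = h (\<eta>\<^sub>1g\<^sub>1 + \<dots> + \<eta>\<^sub>4g\<^sub>4)\<close> one gets
  \<open>G(f) = h\<^sub>0g\<^sub>1(x\<^sup>n + 1) + s(x\<^sup>n - 1)\<close> with \<open>s\<close> in the ideal of \<open>g\<^sub>2, g\<^sub>3, g\<^sub>4\<close>; since
  \<open>g\<^sub>1\<close> divides \<open>x\<^sup>n - 1\<close> and \<open>\<lambda>\<close> divides both \<open>x\<^sup>n + 1\<close> and \<open>s\<close>, the product
  \<open>g\<^sub>1\<lambda>\<close> divides \<open>G(f)\<close>.
\<close>

section \<open>Residue class rings of polynomials\<close>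

lemma ideal_cc_modulus: "ideal (cc_modulus n a) ring_of_type_algebra"
  unfolding cc_modulus_def
  by (rule cring.cgenideal_ideal[OF cring_from_type_algebra])
    (simp add: ring_of_type_algebra_def)

lemma cc_class_ring_hom_ring:
  "ring_hom_ring ring_of_type_algebra (cc_ring n a) (cc_class n a)"
  using ideal.rcos_ring_hom_ring[OF ideal_cc_modulus[of n a]]
  unfolding cc_ring_def cc_class_def[abs_def] .

lemma cc_class_mult:
  "cc_class n a f \<otimes>\<^bsub>cc_ring n a\<^esub> cc_class n a g = cc_class n a (f * g)"
  using Ring.ring_hom_mult[OF ring_hom_ring.homh[OF cc_class_ring_hom_ring[of n a]], of f g]
  by (simp add: ring_of_type_algebra_def)

lemma carrier_cc_ring: "carrier (cc_ring n a) = range (cc_class n a)"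
  by (auto simp: cc_ring_def cc_class_def FactRing_def A_RCOSETS_def' ring_of_type_algebra_def)

lemma PIdl_cc_class:
  "PIdl\<^bsub>cc_ring n a\<^esub> (cc_class n a f) = range (\<lambda>h. cc_class n a (h * f))"
  unfolding cgenideal_def carrier_cc_ring by (auto simp: cc_class_mult) (metis cc_class_mult rangeI)

lemma cc_class_add_multiple:
  "cc_class n a (f + q * (Polynomial.monom 1 n - [:a:])) = cc_class n a f"
proof -
  define m where "m = Polynomial.monom 1 n - [:a:]"
  \<comment> \<open>The two identities shift the cofactor by \<open>q\<close> in opposite
    directions, one for each inclusion.\<close>
  have "f + q * m + r * m = f + (q + r) * m" "f + r * m = f + q * m + (r - q) * m" for r
    by (simp_all add: algebra_simps)
  thus ?thesis unfolding cc_class_eq m_def[symmetric] by blast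
qed

text \<open>Replaces carriers by type class operations. Negatives need no clause of their own, being
  multiples by \<open>- 1\<close>.\<close>

lemma ideal_ring_of_type_algebra_iff:
  fixes S :: "'a::comm_ring_1 set"
  shows "ideal S ring_of_type_algebra \<longleftrightarrow>
    0 \<in> S \<and> (\<forall>x\<in>S. \<forall>y\<in>S. x + y \<in> S) \<and> (\<forall>x. \<forall>y\<in>S. x * y \<in> S)"
proof
  assume "ideal S ring_of_type_algebra"
  then interpret I: ideal S "ring_of_type_algebra" .
  show "0 \<in> S \<and> (\<forall>x\<in>S. \<forall>y\<in>S. x + y \<in> S) \<and> (\<forall>x. \<forall>y\<in>S. x * y \<in> S)"
    using additive_subgroup.zero_closed[OF I.is_additive_subgroup]
      additive_subgroup.a_closed[OF I.is_additive_subgroup] I.I_l_closed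
    unfolding ring_of_type_algebra_def by simp_all
next
  let ?R = "ring_of_type_algebra :: 'a ring"
  interpret R: ring ?R by (rule ring_from_type_algebra)
  assume S: "0 \<in> S \<and> (\<forall>x\<in>S. \<forall>y\<in>S. x + y \<in> S) \<and> (\<forall>x. \<forall>y\<in>S. x * y \<in> S)"
  hence S': "x * y \<in> S" if "x \<in> S" for x y
    using that by (metis mult.commute)
  have neg: "\<ominus>\<^bsub>?R\<^esub> x = - x" for x
    by (rule R.minus_equality) (auto simp: ring_of_type_algebra_def)
  show "ideal S ?R"
  proof (rule idealI)
    show "subgroup S (add_monoid ?R)"
    proof (rule R.add.subgroupI)
      fix x assume "x \<in> S"
      hence "(- 1) * x \<in> S" using S by blast
      thus "\<ominus>\<^bsub>?R\<^esub> x \<in> S" by (simp add: neg)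
    qed (use S in \<open>auto simp: ring_of_type_algebra_def\<close>)
  qed (use S S' R.ring_axioms in \<open>auto simp: ring_of_type_algebra_def\<close>)
qed

text \<open>Together with \<open>ideal_vimage_cc_class\<close> this moves ideals between the
  polynomial ring and its quotient, so codes can be handled as sets of polynomials.\<close>

lemma constacyclic_code_image_cc_class:
  assumes "ideal S ring_of_type_algebra"
  shows "constacyclic_code n a (cc_class n a ` S)"
  using ring.ring_ideal_imp_quot_ideal[OF ring_from_type_algebra ideal_cc_modulus[of n a] assms]
  unfolding constacyclic_code_def cc_ring_def cc_class_def[abs_def] .

lemma ideal_vimage_cc_class:
  assumes "constacyclic_code n a C"
  shows "ideal {f. cc_class n a f \<in> C} ring_of_type_algebra"
  using ring_hom_ring.ideal_vimage[OF cc_class_ring_hom_ring assms[unfolded constacyclic_code_def]]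
  by (simp add: ring_of_type_algebra_def)

lemma constacyclic_code_eq_image:
  assumes "constacyclic_code n a C"
  shows "C = cc_class n a ` {f. cc_class n a f \<in> C}"
proof -
  have "C \<subseteq> carrier (cc_ring n a)"
    using assms unfolding constacyclic_code_def
    by (simp add: additive_subgroup.a_subset ideal.axioms(1))
  thus ?thesis by (auto simp: carrier_cc_ring)
qed

text \<open>The modulus is monic, so division with remainder works over any commutative ring; it is
  applied to coefficients in \<open>ru\<close>, which has zero divisors.\<close>

lemma decompose_word_plus_multiple:
  fixes f :: "'a::comm_ring_1 poly"
  assumes "n > 0"
  obtains r q where "r \<in> words n" "f = r + q * (Polynomial.monom 1 n - [:a:])"
proof -
  define m where "m = Polynomial.monom 1 n - [:a:]"
  have cn: "Polynomial.coeff m n = 1"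
    using assms by (cases n) (simp_all add: m_def)
  have "degree m \<le> n"
    unfolding m_def by (rule degree_diff_le) (auto simp: degree_monom_le)
  with cn have dm: "degree m = n" by (intro antisym le_degree) auto
  have "m \<noteq> 0" using cn by auto
  obtain q r where qr: "pseudo_divmod f m = (q, r)" by fastforce
  note pd = pseudo_divmod[OF \<open>m \<noteq> 0\<close> qr]
  \<comment> \<open>Pseudo-division scales \<open>f\<close> by a power of the leading coefficient of
    \<open>m\<close>, which is 1.\<close>
  have "f = r + q * m" using pd(1) cn dm by (simp add: algebra_simps)
  moreover have "r \<in> words n" using pd(2) dm assms by (auto simp: words_def)
  ultimately show ?thesis using that by (simp add: m_def)
qed


section \<open>The Gray map on polynomials of arbitrary degree\<close>

lemma map_poly_additive:
  assumes "\<phi> 0 = 0" "\<And>x y. \<phi> (x + y) = \<phi> x + \<phi> y"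
  shows "map_poly \<phi> (f + g) = map_poly \<phi> f + map_poly \<phi> g"
  by (rule poly_eqI) (simp add: coeff_map_poly assms)

text \<open>Scalars act through \<open>\<psi>\<close>, and \<open>\<phi>\<close> is linear for this
  action; the convolution formula for coefficients carries this over to polynomials.\<close>

lemma map_poly_semilinear:
  fixes \<phi> :: "'b::comm_ring_1 \<Rightarrow> 'a::comm_ring_1"
  assumes "\<psi> 0 = 0" "\<phi> 0 = 0" "\<And>x y. \<phi> (x + y) = \<phi> x + \<phi> y" "\<And>c r. \<phi> (\<psi> c * r) = c * \<phi> r"
  shows "map_poly \<phi> (map_poly \<psi> h * f) = h * map_poly \<phi> f"
proof (rule poly_eqI)
  fix i
  have sum: "\<phi> (sum F A) = (\<Sum>x\<in>A. \<phi> (F x))" for F and A :: "nat set"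
    by (induction A rule: infinite_finite_induct) (simp_all add: assms)
  show "Polynomial.coeff (map_poly \<phi> (map_poly \<psi> h * f)) i =
      Polynomial.coeff (h * map_poly \<phi> f) i"
    by (simp add: coeff_map_poly coeff_mult sum assms)
qed

lemma ru_coeff_simps [simp]:
  "ru_coeff0 0 = 0" "ru_coeff3 0 = 0"
  "ru_coeff0 (x + y) = ru_coeff0 x + ru_coeff0 y"
  "ru_coeff3 (x + y) = ru_coeff3 x + ru_coeff3 y"
  "ru_coeff0 (ru_const c * x) = c * ru_coeff0 x"
  "ru_coeff3 (ru_const c * x) = c * ru_coeff3 x"
  "ru_const 0 = 0"
  by (simp_all add: zero_ru_def plus_ru_def times_ru_def ru_const_def)

lemma map_poly_ru_coeff_add [simp]:
  "map_poly ru_coeff0 (f + g) = map_poly ru_coeff0 f + map_poly ru_coeff0 g"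
  "map_poly ru_coeff3 (f + g) = map_poly ru_coeff3 f + map_poly ru_coeff3 g"
  by (simp_all add: map_poly_additive)

lemma map_poly_ru_coeff_mult [simp]:
  "map_poly ru_coeff0 (map_poly ru_const h * f) = h * map_poly ru_coeff0 f"
  "map_poly ru_coeff3 (map_poly ru_const h * f) = h * map_poly ru_coeff3 f"
  by (simp_all add: map_poly_semilinear)

lemma gray_poly_add: "gray_poly n (f + g) = gray_poly n f + gray_poly n g"
  by (simp add: gray_poly_def Let_def smult_add_right algebra_simps)

lemma gray_poly_mult: "gray_poly n (map_poly ru_const h * f) = h * gray_poly n f"
  unfolding gray_poly_def Let_def map_poly_ru_coeff_mult by (simp add: algebra_simps)

lemma gray_poly_zero [simp]: "gray_poly n 0 = 0"
  by (simp add: gray_poly_def)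

lemma monom_times_monom: "Polynomial.monom 1 n * Polynomial.monom 1 n =
    (Polynomial.monom 1 (2 * n) :: 'a::comm_ring_1 poly)"
  by (simp add: mult_monom mult_2)

lemma smult_two: "Polynomial.smult 2 f = (2 * f :: 'a::comm_ring_1 poly)"
  by (simp add: numeral_poly)

lemma gray_poly_multiple:
  fixes q :: "'a::comm_ring_1 ru poly"
  shows "\<exists>q'. gray_poly n (q * (Polynomial.monom 1 n - [:1 - 2 * ru_u ^ 3:])) =
    q' * (Polynomial.monom 1 (2 * n) - [:1:])"
proof -
  define Y where "Y = (Polynomial.monom 1 n :: 'a poly)"
  define a where "a = map_poly ru_coeff0 q"
  define d where "d = map_poly ru_coeff3 q"
  \<comment> \<open>Only factors with coefficients in the base ring can be pulled through the
    coefficient maps, so the product is split into \<open>x^n * q\<close> and the part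
    \<open>t\<close> coming from the constant term.\<close>
  define t where "t = - Polynomial.smult (1 - 2 * ru_u ^ 3) q"
  have Y': "map_poly ru_const Y = Polynomial.monom 1 n"
    by (simp add: Y_def map_poly_monom) (simp add: ru_const_def one_ru_def)
  have coeffs:
      "ru_coeff0 (- ((1 - 2 * ru_u ^ 3) * x)) = - ru_coeff0 x"
      "ru_coeff3 (- ((1 - 2 * ru_u ^ 3) * x)) = 2 * ru_coeff0 x + ru_coeff3 x"
    for x :: "'a ru"
  proof -
    have two: "(2 :: 'a ru) = RU 2 0 0 0"
      unfolding one_add_one[symmetric] by (simp add: one_ru_def plus_ru_def)
    show "ru_coeff0 (- ((1 - 2 * ru_u ^ 3) * x)) = - ru_coeff0 x"
      "ru_coeff3 (- ((1 - 2 * ru_u ^ 3) * x)) = 2 * ru_coeff0 x + ru_coeff3 x"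
      unfolding two by (simp_all add: ru_u_def times_ru_def one_ru_def minus_ru_def
        uminus_ru_def power3_eq_cube algebra_simps)
  qed
  have t: "map_poly ru_coeff0 t = - a" "map_poly ru_coeff3 t = 2 * a + d"
    unfolding smult_two[symmetric]
    by (rule poly_eqI; simp only: t_def a_def d_def coeff_map_poly ru_coeff_simps coeffs
        Polynomial.coeff_minus Polynomial.coeff_smult Polynomial.coeff_add)+
  have q: "q * (Polynomial.monom 1 n - [:1 - 2 * ru_u ^ 3:]) = map_poly ru_const Y * q + t"
    by (simp add: Y' t_def algebra_simps)
  have "gray_poly n (map_poly ru_const Y * q + t) = (2 * a + d) * (Y * Y - 1)"
    unfolding gray_poly_def Let_def map_poly_ru_coeff_add map_poly_ru_coeff_mult t
      a_def[symmetric] d_def[symmetric] Y_def[symmetric]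
    by (simp add: smult_two ring_distribs ac_simps)
  thus ?thesis unfolding q Y_def monom_times_monom by (auto simp: one_pCons)
qed

text \<open>Any representative may replace the reduced one: the two differ by a multiple of the
  modulus, which \<open>gray_poly_multiple\<close> sends to zero in the target ring.\<close>

lemma gray_cc_class:
  assumes "n > 0"
  shows "gray n (cc_class n (1 - 2 * ru_u ^ 3) f) = cc_class (2 * n) 1 (gray_poly n f)"
proof -
  obtain r q where r: "r \<in> words n"
    and f: "f = r + q * (Polynomial.monom 1 n - [:1 - 2 * ru_u ^ 3:])"
    using decompose_word_plus_multiple[OF assms] .
  obtain q' where "gray_poly n (q * (Polynomial.monom 1 n - [:1 - 2 * ru_u ^ 3:])) =
      q' * (Polynomial.monom 1 (2 * n) - [:1:])"
    using gray_poly_multiple by blast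
  thus ?thesis unfolding f cc_class_add_multiple gray_def reduced_rep_cc_class[OF r]
    by (simp add: gray_poly_add cc_class_add_multiple)
qed

lemma cyclic_code_gray_image:
  fixes C :: "'a::comm_ring_1 ru poly set set"
  assumes "n > 0" "constacyclic_code n (1 - 2 * ru_u ^ 3) C"
  shows "cyclic_code (2 * n) (gray n ` C)"
proof -
  define S where "S = {f. cc_class n (1 - 2 * ru_u ^ 3) f \<in> C}"
  have S: "0 \<in> S" "\<And>x y. x \<in> S \<Longrightarrow> y \<in> S \<Longrightarrow> x + y \<in> S" "\<And>x y. y \<in> S \<Longrightarrow> x * y \<in> S"
    using ideal_vimage_cc_class[OF assms(2)]
    unfolding S_def[symmetric] ideal_ring_of_type_algebra_iff by auto
  have "ideal (gray_poly n ` S) ring_of_type_algebra"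
    unfolding ideal_ring_of_type_algebra_iff
    \<comment> \<open>A scalar \<open>h\<close> acts on the image through
      \<open>map_poly ru_const h\<close>, and \<open>S\<close> is closed under multiplication by
      it.\<close>
    using S by (auto simp flip: gray_poly_add gray_poly_mult intro: image_eqI[of _ _ 0])
  from constacyclic_code_image_cc_class[OF this]
  have "cyclic_code (2 * n) (cc_class (2 * n) 1 ` gray_poly n ` S)" .
  also have "cc_class (2 * n) 1 ` gray_poly n ` S = gray n ` cc_class n (1 - 2 * ru_u ^ 3) ` S"
    by (simp add: image_image gray_cc_class[OF assms(1)])
  finally show ?thesis
    using constacyclic_code_eq_image[OF assms(2)] unfolding S_def by simp
qed

text \<open>Multiples of \<open>eta \<xi> 1\<close> have opposite coefficients at 1 and
  \<open>u^3\<close>, which gives the factor \<open>x^n + 1\<close>. The other three idempotents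
  have no constant coefficient, so only \<open>u^3\<close> contributes, with factor
  \<open>x^n - 1\<close>.\<close>

lemma gray_poly_eta_combination:
  fixes g :: "nat \<Rightarrow> 'a::field poly"
  obtains a s2 s3 s4 where
    "gray_poly n (h * eta_combination \<xi> g) =
      a * g 1 * (Polynomial.monom 1 n + 1) +
      (s2 * g 2 + s3 * g 3 + s4 * g 4) * (Polynomial.monom 1 n - 1)"
proof -
  define Y where "Y = (Polynomial.monom 1 n :: 'a poly)"
  define a where "a = map_poly ru_coeff0 h"
  define s where "s k = map_poly ru_coeff3 (Polynomial.smult (eta \<xi> k) h)" for k
  have eta0: "ru_coeff0 (eta \<xi> 1 * x) = ru_coeff0 x" "ru_coeff3 (eta \<xi> 1 * x) = - ru_coeff0 x"
    "ru_coeff0 (eta \<xi> 2 * x) = 0" "ru_coeff0 (eta \<xi> 3 * x) = 0" "ru_coeff0 (eta \<xi> 4 * x) = 0"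
    for x
    by (simp_all add: eta_def ru_u_def ru_const_def times_ru_def plus_ru_def minus_ru_def
        one_ru_def power2_eq_square power3_eq_cube)
  have eta: "map_poly ru_coeff0 (Polynomial.smult (eta \<xi> 1) h) = a"
    "map_poly ru_coeff0 (Polynomial.smult (eta \<xi> 2) h) = 0"
    "map_poly ru_coeff0 (Polynomial.smult (eta \<xi> 3) h) = 0"
    "map_poly ru_coeff0 (Polynomial.smult (eta \<xi> 4) h) = 0"
    "s 1 = - a"
    unfolding s_def
    by (rule poly_eqI; simp add: a_def coeff_map_poly eta0[unfolded One_nat_def])+
  have set: "{1..4::nat} = {1, 2, 3, 4}" by auto
  have f: "h * eta_combination \<xi> g =
      map_poly ru_const (g 1) * Polynomial.smult (eta \<xi> 1) h +
      map_poly ru_const (g 2) * Polynomial.smult (eta \<xi> 2) h +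
      map_poly ru_const (g 3) * Polynomial.smult (eta \<xi> 3) h +
      map_poly ru_const (g 4) * Polynomial.smult (eta \<xi> 4) h"
    unfolding eta_combination_def set by (simp add: algebra_simps)
  have "gray_poly n (h * eta_combination \<xi> g) = a * g 1 * (Y + 1) +
      (s 2 * g 2 + s 3 * g 3 + s 4 * g 4) * (Y - 1)"
    unfolding gray_poly_def Let_def f map_poly_ru_coeff_add map_poly_ru_coeff_mult eta
      s_def[symmetric] Y_def[symmetric]
    by (simp add: smult_two ring_distribs ac_simps)
  thus ?thesis using that unfolding Y_def by blast
qed

section \<open>Containment in the ideal of \<open>g 1\<close> times the gcd\<close>

lemma generator_poly_dvd:
  "generator_poly n a D g \<Longrightarrow> g dvd Polynomial.monom 1 n - [:a:]"
  by (simp add: generator_poly_def)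

theorem theorem6:
  fixes \<xi> :: "'p::prime_card mod_ring"
    and n :: nat
    and C :: "'p mod_ring ru poly set set"
    and g :: "nat \<Rightarrow> 'p mod_ring poly"
  assumes "CARD('p) mod 3 = 1"
    and "primitive_root_of_unity 3 \<xi>"
    and "n > 0"
    and "constacyclic_code n (1 - 2 * ru_u ^ 3) C"
    and "C = PIdl\<^bsub>cc_ring n (1 - 2 * ru_u ^ 3)\<^esub>
               (cc_class n (1 - 2 * ru_u ^ 3) (eta_combination \<xi> g))"
    and "generator_poly n 1 (component_code \<xi> n C 1) (g 1)"
    and "\<forall>i\<in>{2,3,4}. generator_poly n (- 1) (component_code \<xi> n C i) (g i)"
  shows "cyclic_code (2 * n) (gray n ` C) \<and>
    gray n ` C \<subseteq>
      PIdl\<^bsub>cc_ring (2 * n) 1\<^esub> (cc_class (2 * n) 1 (g 1 * gcd (g 2) (gcd (g 3) (g 4))))"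
proof
  show "cyclic_code (2 * n) (gray n ` C)"
    using assms(3,4) by (rule cyclic_code_gray_image)
next
  let ?X = "Polynomial.monom 1 n :: 'p mod_ring poly"
  let ?L = "gcd (g 2) (gcd (g 3) (g 4))"
  have g1: "g 1 dvd ?X - 1"
    using generator_poly_dvd[OF assms(6)] by (simp add: one_pCons)
  have "generator_poly n (- 1) (component_code \<xi> n C 2) (g 2)"
    using assms(7) by simp
  hence "g 2 dvd ?X - [:- 1:]" by (rule generator_poly_dvd)
  moreover have "[:- 1:] = (- 1 :: 'p mod_ring poly)" by (simp add: one_pCons)
  ultimately have "g 2 dvd ?X + 1" by simp
  hence L: "?L dvd ?X + 1" by (rule dvd_trans[OF gcd_dvd1])
  have dvd: "g 1 * ?L dvd gray_poly n (h * eta_combination \<xi> g)" for h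
  proof -
    obtain a s2 s3 s4 where eq: "gray_poly n (h * eta_combination \<xi> g) =
        a * g 1 * (?X + 1) + (s2 * g 2 + s3 * g 3 + s4 * g 4) * (?X - 1)"
      using gray_poly_eta_combination .
    have "?L dvd g 2" "?L dvd g 3" "?L dvd g 4"
      by (auto intro: dvd_trans[OF gcd_dvd2])
    hence "?L dvd s2 * g 2 + s3 * g 3 + s4 * g 4" by (intro dvd_add dvd_mult)
    \<comment> \<open>In each summand \<open>?L\<close> and \<open>g 1\<close> divide two different
      factors, so their product divides without any coprimality.\<close>
    hence "?L * g 1 dvd (s2 * g 2 + s3 * g 3 + s4 * g 4) * (?X - 1)"
      using g1 by (rule mult_dvd_mono)
    moreover have "g 1 * ?L dvd a * g 1 * (?X + 1)"
      using L by (intro mult_dvd_mono) auto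
    ultimately show ?thesis unfolding eq by (simp add: mult.commute)
  qed
  show "gray n ` C \<subseteq> PIdl\<^bsub>cc_ring (2 * n) 1\<^esub> (cc_class (2 * n) 1 (g 1 * ?L))"
  proof
    fix A assume "A \<in> gray n ` C"
    \<comment> \<open>Here \<open>h\<close> ranges over all polynomials over \<open>ru\<close>, so
      the product is in general not a word and \<open>gray_cc_class\<close> is what evaluates
      \<open>gray\<close> on its class.\<close>
    then obtain h where A: "A = cc_class (2 * n) 1 (gray_poly n (h * eta_combination \<xi> g))"
      unfolding assms(5) PIdl_cc_class by (auto simp: gray_cc_class[OF assms(3)])
    obtain k where "gray_poly n (h * eta_combination \<xi> g) = k * (g 1 * ?L)"
      using dvd[of h] by (metis dvd_def mult.commute)
    thus "A \<in> PIdl\<^bsub>cc_ring (2 * n) 1\<^esub> (cc_class (2 * n) 1 (g 1 * ?L))"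
      unfolding A PIdl_cc_class by simp
  qed
qed

end
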